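(* Let $n\ge3$ and let $A=(a_{ij})\in\mathbb{M}(n)$ be a nonnegative symmetric matrix. Then the second smallest eigenvalue of $A$ is less than or equal to the third smallest diagonal entry of $A$.
   Context: $\mathbb{M}(n)$ is the algebra of all $n\times n$ complex matrices. A matrix $A=(a_{ij})$ is nonnegative if $a_{ij}\ge0$ for all $i,j$ (entrywise). Eigenvalues and diagonal entries are counted with multiplicity: if $\lambda_1(A)\le\dots\le\lambda_n(A)$ are the eigenvalues and $b_{11}\le\dots\le b_{nn}$ is the nondecreasing rearrangement of the diagonal entries, the second smallest eigenvalue is $\lambda_2(A)$ and the third smallest diagonal entry is $b_{33}$. *)

theory Defs
  imports "Jordan_Normal_Form.Char_Poly"
begin

text \<open>
  The order on complex numbers is the one of HOL-Library: \<open>0 \<le> z\<close> says that \<open>z\<close> is real and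
  nonnegative.
\<close>

definition nonneg_mat :: "complex mat \<Rightarrow> bool" where
  "nonneg_mat A \<longleftrightarrow> (\<forall>i < dim_row A. \<forall>j < dim_col A. 0 \<le> A $$ (i, j))"

definition symmetric_mat :: "'a mat \<Rightarrow> bool" where
  "symmetric_mat A \<longleftrightarrow> transpose_mat A = A"

text \<open>
  The two lists below are meant for matrices whose eigenvalues, respectively diagonal entries, are
  real; there \<open>Re\<close> only changes the type. Both are indexed from 0, so the \<open>k\<close>-th smallest
  member is at position \<open>k - 1\<close>. Eigenvalues are repeated according to their multiplicity as
  roots of the characteristic polynomial.
\<close>

definition sorted_eigenvalues :: "complex mat \<Rightarrow> real list" where
  "sorted_eigenvalues A = sorted_list_of_multiset (image_mset Re (proots (char_poly A)))"

definition sorted_diagonal :: "complex mat \<Rightarrow> real list" where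
  "sorted_diagonal A = sort (map Re (diag_mat A))"

text \<open>Nothing is lost by taking real parts for nonnegative symmetric matrices.\<close>

lemma eigenvalue_real:
  assumes A: "A \<in> carrier_mat n n" and nn: "nonneg_mat A" and sym: "symmetric_mat A"
    and ev: "eigenvalue A k"
  shows "k \<in> \<real>"
proof -
  obtain v where v: "v \<in> carrier_vec n" "v \<noteq> 0\<^sub>v n" "A *\<^sub>v v = k \<cdot>\<^sub>v v"
    using ev A by (auto simp: eigenvalue_def eigenvector_def)
  have row: "(\<Sum>j<n. A $$ (i, j) * v $ j) = k * v $ i" if "i < n" for i
  proof -
    have "(A *\<^sub>v v) $ i = k * v $ i" using that v by simp
    then show ?thesis
      using that A v(1) by (simp add: scalar_prod_def atLeast0LessThan)
  qed
  have real: "cnj (A $$ (i, j)) = A $$ (i, j)" if "i < n" "j < n" for i j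
    using that nn A by (auto simp: nonneg_mat_def less_eq_complex_def complex_eq_iff)
  have symm: "A $$ (i, j) = A $$ (j, i)" if "i < n" "j < n" for i j
    using that A sym unfolding symmetric_mat_def by (metis carrier_matD index_transpose_mat(1))
  define S where "S = (\<Sum>i<n. cnj (v $ i) * v $ i)"
  define Q where "Q = (\<Sum>i<n. \<Sum>j<n. cnj (v $ i) * A $$ (i, j) * v $ j)"
  have "Q = (\<Sum>i<n. cnj (v $ i) * (k * v $ i))"
    unfolding Q_def
    by (intro sum.cong refl) (simp flip: row add: sum_distrib_left mult.assoc)
  then have QS: "Q = k * S"
    by (simp add: S_def sum_distrib_left mult_ac)
  have "cnj Q = (\<Sum>i<n. \<Sum>j<n. cnj (v $ j) * A $$ (j, i) * v $ i)"
    unfolding Q_def cnj_sum by (intro sum.cong refl) (simp add: real symm mult_ac)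
  also have "\<dots> = Q"
    unfolding Q_def by (rule sum.swap)
  finally have "cnj Q = Q" .
  moreover have "S = of_real (\<Sum>i<n. (cmod (v $ i))\<^sup>2)"
    by (simp add: S_def complex_norm_square mult.commute del: of_real_power)
  then have S: "S \<in> \<real>" by (metis Reals_of_real)
  moreover have "S \<noteq> 0"
  proof
    assume "S = 0"
    then have "(\<Sum>i<n. (cmod (v $ i))\<^sup>2) = 0"
      using \<open>S = of_real _\<close> by (metis of_real_eq_0_iff)
    then have "\<forall>i<n. v $ i = 0" by (subst (asm) sum_nonneg_eq_0_iff) auto
    then show False using v by (auto simp: vec_eq_iff)
  qed
  ultimately have "cnj k = k"
    using QS by (simp add: Reals_cnj_iff)
  then show ?thesis by (simp add: Reals_cnj_iff)
qed

lemma mset_sorted_eigenvalues: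
  assumes "A \<in> carrier_mat n n" "nonneg_mat A" "symmetric_mat A"
  shows "image_mset complex_of_real (mset (sorted_eigenvalues A)) = proots (char_poly A)"
proof -
  have "char_poly A \<noteq> 0" using degree_monic_char_poly[OF assms(1)] by auto
  then have "complex_of_real (Re x) = x" if "x \<in># proots (char_poly A)" for x
    using that eigenvalue_real[OF assms, of x] eigenvalue_root_char_poly[OF assms(1), of x]
    by simp
  then have "image_mset (complex_of_real \<circ> Re) (proots (char_poly A)) = proots (char_poly A)"
    by (metis (no_types, lifting) comp_apply image_mset_cong image_mset.identity id_apply)
  then show ?thesis by (simp add: sorted_eigenvalues_def image_mset.compositionality)
qed

lemma length_sorted_eigenvalues:
  "A \<in> carrier_mat n n \<Longrightarrow> length (sorted_eigenvalues A) = n"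
  using degree_monic_char_poly[of A n] mset_sorted_list_of_multiset
  by (metis sorted_eigenvalues_def size_image_mset size_mset size_proots_complex)

lemma length_sorted_diagonal:
  "A \<in> carrier_mat n n \<Longrightarrow> length (sorted_diagonal A) = n"
  by (simp add: sorted_diagonal_def diag_mat_def)

end

theory Submission
  imports Defs "Jordan_Normal_Form.Schur_Decomposition"
begin

text \<open>
  Let \<open>\<lambda>\<^sub>1 \<le> \<lambda>\<^sub>2 \<le> \<dots>\<close> be the eigenvalues of \<open>A\<close> and \<open>b\<close> its third smallest
  diagonal entry. Since \<open>A\<close> is real symmetric, an eigenvector \<open>w\<close> for \<open>\<lambda>\<^sub>1\<close> can be chosen
  real, and the quadratic form of \<open>A\<close> is at least \<open>\<lambda>\<^sub>2 |x|\<^sup>2\<close> at every \<open>x\<close> orthogonal to \<open>w\<close>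
  (\<open>second_eigenvalue_le_form\<close>). So it is enough to find one nonzero real \<open>x\<close> orthogonal to \<open>w\<close>
  where the form is at most \<open>b |x|\<^sup>2\<close>.

  There are three indices whose diagonal entries are at most \<open>b\<close>, and three real numbers cannot
  have pairwise strictly opposite signs. Hence \<open>w\<^sub>p w\<^sub>q \<ge> 0\<close> for two of these indices, and the
  equation \<open>s w\<^sub>p + t w\<^sub>q = 0\<close> has a nontrivial solution with \<open>s t \<le> 0\<close>. Take \<open>x\<close> with
  entries \<open>s\<close> at \<open>p\<close>, \<open>t\<close> at \<open>q\<close> and zero elsewhere: the off-diagonal contribution
  \<open>2 s t a\<^sub>p\<^sub>q\<close> to the form is nonpositive because \<open>a\<^sub>p\<^sub>q \<ge> 0\<close>, and the diagonal contributes at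
  most \<open>b (s\<^sup>2 + t\<^sup>2)\<close>.

  The lower bound on the form is the spectral theorem for real symmetric matrices, stated here as
  the simultaneous reduction of \<open>A\<close> and the Euclidean norm to sums of squares
  (\<open>principal_axes\<close>). It follows by splitting off one eigenvector at a time. Each step divides
  the characteristic polynomial by one linear factor, which keeps track of multiplicities.
\<close>

section \<open>Spectral theorem for real symmetric matrices\<close>

text \<open>
  Gram--Schmidt, started at a basis whose first member is \<open>v\<close>, gives orthogonal columns that
  are not normalised; dividing them by their lengths makes the inverse of \<open>W\<close> its transpose, so
  that conjugation by \<open>W\<close> preserves symmetry.
\<close>

lemma orthogonal_matrix_with_first_column:
  fixes v :: "real vec"
  assumes v: "v \<in> carrier_vec n" and v0: "v \<noteq> 0\<^sub>v n"
  obtains W c where "W \<in> carrier_mat n n" "transpose_mat W * W = 1\<^sub>m n" "col W 0 = c \<cdot>\<^sub>v v"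
proof -
  interpret cof_vec_space n "TYPE(real)" .
  have n: "n > 0" using v v0 by (cases n) auto
  define b where "b = basis_completion v"
  define ws where "ws = gram_schmidt n b"
  from basis_completion[OF v v0, folded b_def]
  have b: "distinct b" "\<not> lin_dep (set b)" "set b \<subseteq> carrier_vec n" "hd b = v" "length b = n"
    by auto
  from gram_schmidt_result[OF b(3,1,2) ws_def]
  have ws: "set ws \<subseteq> carrier_vec n" "corthogonal ws" "length ws = n" by (auto simp: b(5))
  obtain vs where bv: "b = v # vs" using b(4,5) n by (cases b) auto
  have ws0: "ws ! 0 = v"
    using gram_schmidt_hd[OF v, of vs, folded bv] ws(3) n hd_conv_nth[of ws]
    by (cases ws) (simp_all add: ws_def)
  define r where "r i = 1 / sqrt (ws ! i \<bullet> ws ! i)" for i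
  define W where "W = mat n n (\<lambda>(i, j). r j * ws ! j $ i)"
  have wsc: "ws ! i \<in> carrier_vec n" if "i < n" for i using ws that by auto
  have colW: "col W j = r j \<cdot>\<^sub>v ws ! j" if "j < n" for j
    using that wsc[OF that] by (intro eq_vecI) (auto simp: W_def)
  have real_conj: "x \<bullet>c y = x \<bullet> y" for x y :: "real vec"
    by (simp add: scalar_prod_def)
  have W: "W \<in> carrier_mat n n" by (simp add: W_def)
  have "col W i \<bullet> col W j = (if i = j then 1 else 0)" if ij: "i < n" "j < n" for i j
  proof -
    have orth: "ws ! i \<bullet> ws ! j = 0 \<longleftrightarrow> i \<noteq> j"
      using corthogonalD[OF ws(2), of i j] ij ws(3) by (simp add: real_conj)
    have "ws ! i \<bullet> ws ! i \<ge> 0"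
      by (simp add: scalar_prod_def sum_nonneg)
    then show ?thesis using orth wsc[OF ij(1)] wsc[OF ij(2)] ij
      by (auto simp: colW r_def)
  qed
  then have "transpose_mat W * W = 1\<^sub>m n"
    using W by (intro eq_matI) auto
  moreover have "col W 0 = r 0 \<cdot>\<^sub>v v" using colW[OF n] ws0 by simp
  ultimately show ?thesis using that W by blast
qed

text \<open>
  In an orthonormal basis that starts with an eigenvector, the first column of the matrix is
  \<open>e\<close> times the first unit vector; by symmetry so is the first row. The remaining block is again
  symmetric and carries the other eigenvalues.
\<close>

lemma symmetric_deflation:
  fixes A :: "real mat"
  assumes A: "A \<in> carrier_mat (Suc n) (Suc n)" and sym: "symmetric_mat A"
    and cp: "char_poly A = [:- e, 1:] * q"
  obtains W B where "W \<in> carrier_mat (Suc n) (Suc n)" "transpose_mat W * W = 1\<^sub>m (Suc n)"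
    "B \<in> carrier_mat n n" "symmetric_mat B" "char_poly B = q"
    "transpose_mat W * A * W = four_block_mat (mat 1 1 (\<lambda>_. e)) (0\<^sub>m 1 n) (0\<^sub>m n 1) B"
proof -
  have "eigenvalue A e" using cp by (simp add: eigenvalue_root_char_poly[OF A])
  then obtain v where v: "v \<in> carrier_vec (Suc n)" "v \<noteq> 0\<^sub>v (Suc n)" "A *\<^sub>v v = e \<cdot>\<^sub>v v"
    using A by (auto simp: eigenvalue_def eigenvector_def)
  obtain W c where W: "W \<in> carrier_mat (Suc n) (Suc n)" "transpose_mat W * W = 1\<^sub>m (Suc n)"
    and col0: "col W 0 = c \<cdot>\<^sub>v v"
    using orthogonal_matrix_with_first_column[OF v(1,2)] .
  have WW: "W * transpose_mat W = 1\<^sub>m (Suc n)"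
    using mat_mult_left_right_inverse[of "transpose_mat W" "Suc n" W] W by auto
  define A' where "A' = transpose_mat W * A * W"
  have A': "A' \<in> carrier_mat (Suc n) (Suc n)" using A W by (simp add: A'_def)
  have AT: "transpose_mat A = A" using sym by (simp add: symmetric_mat_def)
  have "transpose_mat A' = transpose_mat W * (transpose_mat A * W)"
    unfolding A'_def using A W(1) by (simp add: transpose_mult[of _ "Suc n" "Suc n" _ "Suc n"])
  also have "\<dots> = A'"
    unfolding A'_def AT using A W(1)
    by (simp add: assoc_mult_mat[of _ "Suc n" "Suc n" _ "Suc n" _ "Suc n"])
  finally have symA': "transpose_mat A' = A'" .
  have entry: "A' $$ (j, i) = A' $$ (i, j)" if "i < Suc n" "j < Suc n" for i j
    using that A' symA' by (metis carrier_matD index_transpose_mat(1))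
  have first_col: "A' $$ (i, 0) = (if i = 0 then e else 0)" if i: "i < Suc n" for i
  proof -
    have "A' $$ (i, 0) = col W i \<bullet> col (A * W) 0"
      using i A W(1) by (simp add: A'_def assoc_mult_mat[of _ "Suc n" "Suc n" _ "Suc n" _ "Suc n"])
    also have "col (A * W) 0 = A *\<^sub>v col W 0" using A W(1) by (intro eq_vecI) auto
    also have "\<dots> = e \<cdot>\<^sub>v col W 0"
      using A v by (simp add: col0 mult_mat_vec smult_smult_assoc mult.commute)
    also have "col W i \<bullet> (e \<cdot>\<^sub>v col W 0) = e * (transpose_mat W * W) $$ (i, 0)"
      using i W(1) by simp
    also have "\<dots> = (if i = 0 then e else 0)" using i by (simp add: W(2))
    finally show ?thesis .
  qed
  define B where "B = mat n n (\<lambda>(i, j). A' $$ (Suc i, Suc j))"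
  have B: "B \<in> carrier_mat n n" by (simp add: B_def)
  have symB: "symmetric_mat B"
    unfolding symmetric_mat_def by (intro eq_matI) (auto simp: B_def entry)
  have block: "A' = four_block_mat (mat 1 1 (\<lambda>_. e)) (0\<^sub>m 1 n) (0\<^sub>m n 1) B"
  proof (intro eq_matI)
    fix i j assume "i < dim_row (four_block_mat (mat 1 1 (\<lambda>_. e)) (0\<^sub>m 1 n) (0\<^sub>m n 1) B)"
      "j < dim_col (four_block_mat (mat 1 1 (\<lambda>_. e)) (0\<^sub>m 1 n) (0\<^sub>m n 1) B)"
    then have ij: "i < Suc n" "j < Suc n" using B by auto
    then show "A' $$ (i, j) = four_block_mat (mat 1 1 (\<lambda>_. e)) (0\<^sub>m 1 n) (0\<^sub>m n 1) B $$ (i, j)"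
      using B first_col[of i] first_col[of j] entry[of 0 j] by (cases i; cases j) (auto simp: B_def)
  qed (use A' B in auto)
  have "similar_mat_wit A' A (transpose_mat W) W"
    by (rule similar_mat_witI[of _ _ "Suc n"]) (use A A' W WW in \<open>auto simp: A'_def\<close>)
  then have "char_poly A' = char_poly A"
    using char_poly_similar similar_mat_def by blast
  moreover have "char_poly A' = char_poly (mat 1 1 (\<lambda>_. e)) * char_poly B"
    unfolding block by (rule char_poly_four_block_zeros_col) (use B in auto)
  moreover have "char_poly (mat 1 1 (\<lambda>_. e)) = [:- e, 1:]"
    by (simp add: char_poly_defs det_def sign_def)
  ultimately have "[:- e, 1:] * char_poly B = [:- e, 1:] * q" using cp by metis
  then have "char_poly B = q" by (metis mult_cancel_left pCons_eq_0_iff zero_neq_one)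
  then show ?thesis using that W B symB block unfolding A'_def by blast
qed

text \<open>
  The \<open>us\<close> are an orthonormal basis of eigenvectors, in the order of the list \<open>es\<close>.
  Describing them by the two quadratic forms alone makes the induction step a change of variables
  \<open>z = W\<^sup>T x\<close>, with no product of block matrices.
\<close>

theorem principal_axes:
  fixes A :: "real mat"
  assumes "A \<in> carrier_mat n n" and "symmetric_mat A"
    and "char_poly A = (\<Prod>e\<leftarrow>es. [:- e, 1:])"
  shows "\<exists>us. length us = n \<and> set us \<subseteq> carrier_vec n \<and>
    (\<forall>x \<in> carrier_vec n. x \<bullet> x = (\<Sum>i<n. (us ! i \<bullet> x)\<^sup>2) \<and>
       x \<bullet> (A *\<^sub>v x) = (\<Sum>i<n. es ! i * (us ! i \<bullet> x)\<^sup>2))"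
  using assms
proof (induction n arbitrary: A es)
  case 0
  then show ?case by (auto simp: scalar_prod_def)
next
  case (Suc n)
  have "degree (\<Prod>e\<leftarrow>es. [:- e, 1:]) = Suc n"
    using degree_monic_char_poly[OF Suc.prems(1)] Suc.prems(3) by simp
  then obtain e es' where es: "es = e # es'" by (cases es) auto
  then have "char_poly A = [:- e, 1:] * (\<Prod>e\<leftarrow>es'. [:- e, 1:])" using Suc.prems(3) by simp
  then obtain W B where W: "W \<in> carrier_mat (Suc n) (Suc n)" "transpose_mat W * W = 1\<^sub>m (Suc n)"
    and B: "B \<in> carrier_mat n n" "symmetric_mat B" "char_poly B = (\<Prod>e\<leftarrow>es'. [:- e, 1:])"
    and block: "transpose_mat W * A * W = four_block_mat (mat 1 1 (\<lambda>_. e)) (0\<^sub>m 1 n) (0\<^sub>m n 1) B"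
    using symmetric_deflation[OF Suc.prems(1,2)] by metis
  have WW: "W * transpose_mat W = 1\<^sub>m (Suc n)"
    using mat_mult_left_right_inverse[of "transpose_mat W" "Suc n" W] W by auto
  obtain us where us: "length us = n" "set us \<subseteq> carrier_vec n"
    and form: "\<And>y. y \<in> carrier_vec n \<Longrightarrow> y \<bullet> y = (\<Sum>i<n. (us ! i \<bullet> y)\<^sup>2)"
      "\<And>y. y \<in> carrier_vec n \<Longrightarrow> y \<bullet> (B *\<^sub>v y) = (\<Sum>i<n. es' ! i * (us ! i \<bullet> y)\<^sup>2)"
    using Suc.IH[OF B] by blast
  \<comment> \<open>The columns of \<open>W\<close> times the block sum of 1 and the axes of \<open>B\<close>.\<close>
  define us' where "us' = col W 0 # map (\<lambda>u. W *\<^sub>v (0\<^sub>v 1 @\<^sub>v u)) us"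
  have us': "set us' \<subseteq> carrier_vec (Suc n)" "length us' = Suc n"
  proof -
    have "0\<^sub>v 1 @\<^sub>v u \<in> carrier_vec (Suc n)" if "u \<in> set us" for u
      using append_carrier_vec[of "0\<^sub>v 1" 1 u n] us(2) that by auto
    then show "set us' \<subseteq> carrier_vec (Suc n)"
      using W(1) by (auto simp: us'_def intro!: col_carrier_vec mult_mat_vec_carrier)
    show "length us' = Suc n" by (simp add: us'_def us(1))
  qed
  have "x \<bullet> x = (\<Sum>i<Suc n. (us' ! i \<bullet> x)\<^sup>2) \<and>
      x \<bullet> (A *\<^sub>v x) = (\<Sum>i<Suc n. es ! i * (us' ! i \<bullet> x)\<^sup>2)" if x: "x \<in> carrier_vec (Suc n)" for x
  proof -
    define z where "z = transpose_mat W *\<^sub>v x"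
    have z: "z \<in> carrier_vec (Suc n)" using x W(1) by (simp add: z_def)
    have x_z: "W *\<^sub>v z = x"
    proof -
      have "W *\<^sub>v z = (W * transpose_mat W) *\<^sub>v x"
        using x W(1) by (simp add: z_def assoc_mult_mat_vec[of _ "Suc n" "Suc n" _ "Suc n"])
      then show ?thesis using x by (simp add: WW)
    qed
    have move: "(W *\<^sub>v a) \<bullet> b = a \<bullet> (transpose_mat W *\<^sub>v b)"
      if "a \<in> carrier_vec (Suc n)" "b \<in> carrier_vec (Suc n)" for a b
    proof -
      have "(W *\<^sub>v a) \<bullet> b = b \<bullet> (W *\<^sub>v a)"
        using that W(1) by (intro comm_scalar_prod[of _ "Suc n"]) auto
      also have "\<dots> = (transpose_mat W *\<^sub>v b) \<bullet> a"
        by (rule transpose_vec_mult_scalar[OF W(1) that, symmetric])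
      also have "\<dots> = a \<bullet> (transpose_mat W *\<^sub>v b)"
        using that W(1) by (intro comm_scalar_prod[of _ "Suc n"]) auto
      finally show ?thesis .
    qed
    define c where "c = vec_first z 1"
    define y where "y = vec_last z n"
    have c: "c \<in> carrier_vec 1" and y: "y \<in> carrier_vec n" and zcy: "z = c @\<^sub>v y"
      using z by (auto simp: c_def y_def)
    have cc: "c \<bullet> d = c $ 0 * d $ 0" if "d \<in> carrier_vec 1" for d
      using that by (simp add: scalar_prod_def)
    have first: "us' ! 0 \<bullet> x = c $ 0"
    proof -
      have "us' ! 0 \<bullet> x = z $ 0" using W(1) by (simp add: us'_def z_def)
      then show ?thesis by (simp add: zcy c[THEN carrier_vecD])
    qed
    have rest: "us' ! Suc i \<bullet> x = us ! i \<bullet> y" if i: "i < n" for i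
    proof -
      have u: "us ! i \<in> carrier_vec n" using us i nth_mem[of i us] by blast
      have "us' ! Suc i \<bullet> x = (0\<^sub>v 1 @\<^sub>v us ! i) \<bullet> z"
        using i us(1) move[OF append_carrier_vec[OF zero_carrier_vec[of 1] u, simplified] x]
        by (simp add: us'_def z_def)
      also have "\<dots> = us ! i \<bullet> y"
        unfolding zcy using c y u by (subst scalar_prod_append[of _ 1 _ n]) auto
      finally show ?thesis .
    qed
    have "x \<bullet> x = z \<bullet> z"
      using move[OF z x] by (simp only: x_z flip: z_def)
    also have "\<dots> = (c $ 0)\<^sup>2 + y \<bullet> y"
      unfolding zcy using c y by (simp add: scalar_prod_append[of _ 1 _ n] cc power2_eq_square)
    also have "\<dots> = (\<Sum>i<Suc n. (us' ! i \<bullet> x)\<^sup>2)"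
      by (simp add: sum.lessThan_Suc_shift first rest form y del: sum.lessThan_Suc)
    finally have norm: "x \<bullet> x = (\<Sum>i<Suc n. (us' ! i \<bullet> x)\<^sup>2)" .
    have "x \<bullet> (A *\<^sub>v x) = z \<bullet> (transpose_mat W *\<^sub>v (A *\<^sub>v x))"
      using move[OF z, of "A *\<^sub>v x"] x Suc.prems(1) by (simp add: x_z)
    also have "transpose_mat W *\<^sub>v (A *\<^sub>v x) = (transpose_mat W * A * W) *\<^sub>v z"
      using z W(1) Suc.prems(1)
      by (simp add: assoc_mult_mat_vec[of _ "Suc n" "Suc n" _ "Suc n"] x_z)
    also have "\<dots> = (mat 1 1 (\<lambda>_. e) *\<^sub>v c) @\<^sub>v (B *\<^sub>v y)"
      unfolding block zcy by (rule mult_mat_vec_split) (use B(1) c y in auto)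
    also have "z \<bullet> \<dots> = c \<bullet> (mat 1 1 (\<lambda>_. e) *\<^sub>v c) + y \<bullet> (B *\<^sub>v y)"
      unfolding zcy
      by (rule scalar_prod_append[OF c y mult_mat_vec_carrier[OF mat_carrier c]
            mult_mat_vec_carrier[OF B(1) y]])
    also have "c \<bullet> (mat 1 1 (\<lambda>_. e) *\<^sub>v c) = e * (c $ 0)\<^sup>2"
      using c by (simp add: scalar_prod_def power2_eq_square)
    also have "e * (c $ 0)\<^sup>2 + y \<bullet> (B *\<^sub>v y) = (\<Sum>i<Suc n. es ! i * (us' ! i \<bullet> x)\<^sup>2)"
      by (simp add: sum.lessThan_Suc_shift first rest form y es del: sum.lessThan_Suc)
    finally show ?thesis using norm by blast
  qed
  with us' show ?case by blast
qed

text \<open>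
  One half of the Courant--Fischer description of the second smallest eigenvalue: on the
  orthogonal complement of the first principal axis only coefficients from \<open>es ! 1\<close> on survive.
\<close>

lemma second_eigenvalue_le_form:
  fixes A :: "real mat"
  assumes A: "A \<in> carrier_mat n n" "symmetric_mat A"
    and es: "char_poly A = (\<Prod>e\<leftarrow>es. [:- e, 1:])" "sorted es" and n: "n \<ge> 2"
  obtains w where "w \<in> carrier_vec n"
    "\<And>x. x \<in> carrier_vec n \<Longrightarrow> w \<bullet> x = 0 \<Longrightarrow> es ! 1 * (x \<bullet> x) \<le> x \<bullet> (A *\<^sub>v x)"
proof -
  obtain us where us: "length us = n" "set us \<subseteq> carrier_vec n"
    and form: "\<And>x. x \<in> carrier_vec n \<Longrightarrow> x \<bullet> x = (\<Sum>i<n. (us ! i \<bullet> x)\<^sup>2)"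
      "\<And>x. x \<in> carrier_vec n \<Longrightarrow> x \<bullet> (A *\<^sub>v x) = (\<Sum>i<n. es ! i * (us ! i \<bullet> x)\<^sup>2)"
    using principal_axes[OF A es(1)] by blast
  have len: "length es = n"
    using degree_monic_char_poly[OF A(1)] degree_linear_factors[of uminus es] es(1) by simp
  have "es ! 1 * (x \<bullet> x) \<le> x \<bullet> (A *\<^sub>v x)" if x: "x \<in> carrier_vec n" "us ! 0 \<bullet> x = 0" for x
    unfolding form[OF x(1)] sum_distrib_left
  proof (rule sum_mono)
    fix i assume "i \<in> {..<n}"
    then show "es ! 1 * (us ! i \<bullet> x)\<^sup>2 \<le> es ! i * (us ! i \<bullet> x)\<^sup>2"
      using x(2) len n es(2) by (cases "i = 0") (auto intro!: mult_right_mono sorted_nth_mono)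
  qed
  moreover have "us ! 0 \<in> carrier_vec n" using us(1) n by (intro subsetD[OF us(2)] nth_mem) simp
  ultimately show ?thesis using that by blast
qed

section \<open>A test vector supported on two small diagonal entries\<close>

text \<open>
  This turns an order statistic, which counts multiplicities, into distinct positions of the
  unsorted list: sorting does not change how many members satisfy a predicate.
\<close>

lemma card_nth_le_nth_sort:
  fixes xs :: "'a :: linorder list"
  assumes k: "k < length xs"
  shows "Suc k \<le> card {i. i < length xs \<and> xs ! i \<le> sort xs ! k}"
proof -
  have "card {..k} \<le> card {i. i < length (sort xs) \<and> sort xs ! i \<le> sort xs ! k}"
    by (rule card_mono) (use k in \<open>auto intro: sorted_nth_mono\<close>)
  also have "\<dots> = length (filter (\<lambda>x. x \<le> sort xs ! k) (sort xs))"
    by (simp add: length_filter_conv_card)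
  also have "\<dots> = length (filter (\<lambda>x. x \<le> sort xs ! k) xs)"
    by (metis filter_sort length_sort)
  also have "\<dots> = card {i. i < length xs \<and> xs ! i \<le> sort xs ! k}"
    by (simp add: length_filter_conv_card)
  finally show ?thesis by simp
qed

lemma two_of_three_same_sign:
  fixes w :: "'a \<Rightarrow> real"
  assumes "card S = 3"
  obtains p q where "p \<in> S" "q \<in> S" "p \<noteq> q" "0 \<le> w p * w q"
proof -
  obtain i j k where S: "S = {i, j, k}" "i \<noteq> j" "j \<noteq> k" "i \<noteq> k"
    using assms by (auto simp: card_3_iff)
  have "0 \<le> w i * w j \<or> 0 \<le> w j * w k \<or> 0 \<le> w i * w k"
    by (auto simp: zero_le_mult_iff)
  then show ?thesis using S that by blast
qed

lemma opposed_signs_solution: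
  fixes a b :: real
  assumes "0 \<le> a * b"
  obtains s t where "s * a + t * b = 0" "s * t \<le> 0" "0 < s\<^sup>2 + t\<^sup>2"
proof (cases "a = 0 \<and> b = 0")
  case True
  \<comment> \<open>Here the generic solution \<open>(b, - a)\<close> used below would be trivial.\<close>
  then show ?thesis using that[of 1 0] by simp
next
  case False
  then show ?thesis
    using that[of b "- a"] assms by (auto simp: sum_power2_gt_zero_iff mult.commute)
qed

lemma form_on_two_unit_vectors:
  fixes A :: "real mat" and s t :: real
  assumes A: "A \<in> carrier_mat n n" and p: "p < n" and q: "q < n" and "p \<noteq> q"
  defines "x \<equiv> s \<cdot>\<^sub>v unit_vec n p + t \<cdot>\<^sub>v unit_vec n q"
  shows "x \<in> carrier_vec n"
    and "w \<in> carrier_vec n \<Longrightarrow> w \<bullet> x = s * w $ p + t * w $ q"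
    and "x \<bullet> x = s\<^sup>2 + t\<^sup>2"
    and "x \<bullet> (A *\<^sub>v x) = s\<^sup>2 * A $$ (p, p) + s * t * (A $$ (p, q) + A $$ (q, p)) + t\<^sup>2 * A $$ (q, q)"
proof -
  show x: "x \<in> carrier_vec n" by (simp add: x_def)
  have lin: "v \<bullet> x = s * v $ p + t * v $ q" if "v \<in> carrier_vec n" for v
    using that p q by (simp add: x_def scalar_prod_add_distrib[of _ n])
  show "w \<in> carrier_vec n \<Longrightarrow> w \<bullet> x = s * w $ p + t * w $ q" by (rule lin)
  have xpq: "x $ p = s" "x $ q = t" using p q \<open>p \<noteq> q\<close> by (auto simp: x_def)
  then show "x \<bullet> x = s\<^sup>2 + t\<^sup>2" using lin[OF x] by (simp add: power2_eq_square)
  have Ax: "A *\<^sub>v x \<in> carrier_vec n" using A x by simp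
  have row: "(A *\<^sub>v x) $ i = s * A $$ (i, p) + t * A $$ (i, q)" if "i < n" for i
    using that A p q lin[of "row A i"] by simp
  have "x \<bullet> (A *\<^sub>v x) = s * (A *\<^sub>v x) $ p + t * (A *\<^sub>v x) $ q"
    using lin[OF Ax] comm_scalar_prod[OF x Ax] by simp
  then show "x \<bullet> (A *\<^sub>v x) = s\<^sup>2 * A $$ (p, p) + s * t * (A $$ (p, q) + A $$ (q, p)) + t\<^sup>2 * A $$ (q, q)"
    unfolding row[OF p] row[OF q] by (simp add: power2_eq_square algebra_simps)
qed

lemma real_second_eigenvalue_le_third_diagonal:
  fixes A :: "real mat"
  assumes A: "A \<in> carrier_mat n n" and sym: "symmetric_mat A"
    and nonneg: "\<And>i j. i < n \<Longrightarrow> j < n \<Longrightarrow> i \<noteq> j \<Longrightarrow> 0 \<le> A $$ (i, j)"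
    and es: "char_poly A = (\<Prod>e\<leftarrow>es. [:- e, 1:])" "sorted es" and n: "n \<ge> 3"
  shows "es ! 1 \<le> sort (diag_mat A) ! 2"
proof -
  define b where "b = sort (diag_mat A) ! 2"
  have len: "length (diag_mat A) = n" using A by (simp add: diag_mat_def)
  have "3 \<le> card {i. i < n \<and> diag_mat A ! i \<le> b}"
    using card_nth_le_nth_sort[of 2 "diag_mat A"] n len by (simp add: b_def)
  then obtain S where S: "S \<subseteq> {i. i < n \<and> diag_mat A ! i \<le> b}" "card S = 3"
    by (meson obtain_subset_with_card_n)
  have diag: "i < n \<and> A $$ (i, i) \<le> b" if "i \<in> S" for i
    using that S(1) A by (auto simp: diag_mat_def)
  obtain w where w: "w \<in> carrier_vec n"
    and bound: "\<And>x. x \<in> carrier_vec n \<Longrightarrow> w \<bullet> x = 0 \<Longrightarrow> es ! 1 * (x \<bullet> x) \<le> x \<bullet> (A *\<^sub>v x)"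
    using second_eigenvalue_le_form[OF A sym es] n by auto
  obtain p q where pq: "p \<in> S" "q \<in> S" "p \<noteq> q" and sign: "0 \<le> w $ p * w $ q"
    using two_of_three_same_sign[OF S(2), of "\<lambda>i. w $ i"] .
  obtain s t where orth: "s * w $ p + t * w $ q = 0" and st: "s * t \<le> 0" "0 < s\<^sup>2 + t\<^sup>2"
    using opposed_signs_solution[OF sign] .
  have p: "p < n" "A $$ (p, p) \<le> b" and q: "q < n" "A $$ (q, q) \<le> b"
    using diag pq by auto
  define x where "x = s \<cdot>\<^sub>v unit_vec n p + t \<cdot>\<^sub>v unit_vec n q"
  note x = form_on_two_unit_vectors[OF A p(1) q(1) pq(3), where s = s and t = t, folded x_def]
  have "es ! 1 * (s\<^sup>2 + t\<^sup>2) \<le> x \<bullet> (A *\<^sub>v x)"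
    using bound[OF x(1)] x(2)[OF w] x(3) orth by simp
  also have "\<dots> = s\<^sup>2 * A $$ (p, p) + s * t * (A $$ (p, q) + A $$ (q, p)) + t\<^sup>2 * A $$ (q, q)"
    by (rule x(4))
  also have "s * t * (A $$ (p, q) + A $$ (q, p)) \<le> 0"
    using p q pq(3) nonneg[of p q] nonneg[of q p] by (intro mult_nonpos_nonneg[OF st(1)]) auto
  also have "s\<^sup>2 * A $$ (p, p) + 0 + t\<^sup>2 * A $$ (q, q) \<le> s\<^sup>2 * b + 0 + t\<^sup>2 * b"
    using p q by (intro add_mono mult_left_mono) auto
  also have "\<dots> = b * (s\<^sup>2 + t\<^sup>2)" by (simp add: algebra_simps)
  finally show ?thesis using st(2) by (simp add: b_def)
qed

section \<open>Nonnegative symmetric complex matrices\<close>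

text \<open>
  A nonnegative complex matrix has real entries, so its characteristic polynomial comes from the
  real matrix with these entries. Its complex roots are real by symmetry; since the embedding of
  polynomials is injective, the factorization into linear factors already holds over the reals.
\<close>

theorem corollary2p7:
  fixes n :: nat and A :: "complex mat"
  assumes "n \<ge> 3"
    and "A \<in> carrier_mat n n"
    and "nonneg_mat A"
    and "symmetric_mat A"
  shows "sorted_eigenvalues A ! 1 \<le> sorted_diagonal A ! 2"
proof -
  note A = assms(2)
  define R where "R = map_mat Re A"
  have R: "R \<in> carrier_mat n n" using A by (simp add: R_def)
  have nn: "0 \<le> Re (A $$ (i, j))" "A $$ (i, j) = of_real (Re (A $$ (i, j)))" if "i < n" "j < n" for i j
    using assms(3) that A by (auto simp: nonneg_mat_def less_eq_complex_def complex_eq_iff)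
  have AR: "A = map_mat of_real R"
    using A nn by (intro eq_matI) (auto simp: R_def)
  have symR: "symmetric_mat R"
    using assms(4) unfolding symmetric_mat_def R_def by (metis map_mat_transpose)
  define es where "es = sorted_eigenvalues A"
  interpret map_poly_inj_idom_hom "of_real :: real \<Rightarrow> complex" ..
  have "map_poly complex_of_real (char_poly R) = char_poly A"
    unfolding AR by (rule of_real_hom.char_poly_hom[OF R, symmetric])
  also have "\<dots> = (\<Prod>z\<in>#proots (char_poly A). [:- z, 1:])"
    using complex_poly_decompose_multiset[of "char_poly A"] degree_monic_char_poly[OF A] by simp
  also have "\<dots> = (\<Prod>z\<in>#image_mset complex_of_real (mset es). [:- z, 1:])"
    unfolding es_def mset_sorted_eigenvalues[OF assms(2-4)] ..
  also have "\<dots> = (\<Prod>e\<leftarrow>es. [:- complex_of_real e, 1:])"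
    by (simp add: image_mset.compositionality comp_def flip: mset_map prod_mset_prod_list)
  also have "\<dots> = map_poly complex_of_real (\<Prod>e\<leftarrow>es. [:- e, 1:])"
    by (induction es) (simp_all add: hom_distribs)
  finally have "char_poly R = (\<Prod>e\<leftarrow>es. [:- e, 1:])"
    by (simp only: eq_iff)
  moreover have "sorted es" by (simp add: es_def sorted_eigenvalues_def)
  moreover have "0 \<le> R $$ (i, j)" if "i < n" "j < n" for i j
    using nn(1) that A by (simp add: R_def)
  ultimately have "es ! 1 \<le> sort (diag_mat R) ! 2"
    using real_second_eigenvalue_le_third_diagonal[OF R symR] assms(1) by blast
  also have "diag_mat R = map Re (diag_mat A)"
    using A by (simp add: R_def diag_mat_def)
  finally show ?thesis by (simp add: es_def sorted_diagonal_def)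
qed

end
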